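(* Let $k$ be a field and let $\mathcal{C}$ be a finite rr-transitive deterministic cancellative category. Then there is a $k$-linear isomorphism $\mathcal{T}:\mathrm{Der}^{\mathrm{gr}}(k\mathcal{C})\rightarrow \mathrm{Char}(F^{\mathrm{ad}}(\mathcal{C}))$ between the space of $S$-graded derivations on $k\mathcal{C}$ and the space of characters on the category $F^{\mathrm{ad}}(\mathcal{C})$.
   Context: A category is finite if it has finitely many objects and all its sets of morphisms are finite. For a morphism $a$, $s(a)$ and $t(a)$ are its source and target. The category algebra $k\mathcal{C}$ is the $k$-vector space with basis $\mathrm{Mor}(\mathcal{C})$ and product $ab=a\circ b$ if $s(a)=t(b)$, and $ab=0$ otherwise. $\mathcal{C}$ is left deterministic if for all $g\in\mathrm{Hom}_{\mathcal{C}}(x_1,x_2)$ and $b\in\mathrm{End}_{\mathcal{C}}(x_2)$ there is $a\in\mathrm{End}_{\mathcal{C}}(x_1)$ with $g\circ a=b\circ g$; right deterministic if for all $g\in\mathrm{Hom}_{\mathcal{C}}(x_1,x_2)$ and $a\in\mathrm{End}_{\mathcal{C}}(x_1)$ there is $b\in\mathrm{End}_{\mathcal{C}}(x_2)$ with $g\circ a=b\circ g$; deterministic if both. $\mathcal{C}$ is cancellative if composition of morphisms is both left and right cancellable. $\mathcal{C}$ is rr-transitive if for all objects $x_1,x_2$ the right action of the monoid $\mathrm{End}_{\mathcal{C}}(x_1)$ on $\mathrm{Hom}_{\mathcal{C}}(x_1,x_2)$ by composition is transitive, i.e. for all $f,g\in\mathrm{Hom}_{\mathcal{C}}(x_1,x_2)$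 there is $a\in\mathrm{End}_{\mathcal{C}}(x_1)$ with $g\circ a=f$. The adjoint category $F^{\mathrm{ad}}(\mathcal{C})$ has as objects all endomorphisms in $\mathcal{C}$; a morphism from $a\in\mathrm{End}_{\mathcal{C}}(x_1)$ to $b\in\mathrm{End}_{\mathcal{C}}(x_2)$ is a $g\in\mathrm{Hom}_{\mathcal{C}}(x_1,x_2)$ with $g\circ a=b\circ g$; composition is that of $\mathcal{C}$. Grading: let $S=\{(x_1,x_2)\in\mathrm{Ob}(\mathcal{C})\times\mathrm{Ob}(\mathcal{C}) : \mathrm{Hom}_{\mathcal{C}}(x_1,x_2)\neq\emptyset\}\cup\{(0,0)\}$. Then $k\mathcal{C}=\bigoplus_{(x_1,x_2)\in S}R_{(x_1,x_2)}$, where $R_{(x_1,x_2)}=k[\mathrm{Hom}_{\mathcal{C}}(x_1,x_2)]$ is the $k$-span of $\mathrm{Hom}_{\mathcal{C}}(x_1,x_2)$ and $R_{(0,0)}=0$. A $k$-linear endomorphism $\phi$ of $k\mathcal{C}$ is $S$-graded if $\phi(R_{(x_1,x_2)})\subseteq R_{(x_1,x_2)}$ for all $(x_1,x_2)\in S$. $\mathrm{Der}^{\mathrm{gr}}(k\mathcal{C})$ is the $k$-space of all $S$-graded $k$-linear derivations $X:k\mathcal{C}\to k\mathcal{C}$ (i.e. $X(uv)=X(u)v+uX(v)$). Characters: for a finite category $\mathcal{D}$, a character on $\mathcal{D}$ is a map of sets $T:\mathrm{Mor}(\mathcal{D})\to k$ with $T(\eta\circ\zeta)=T(\eta)+T(\zeta)$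 for all morphisms $\zeta,\eta$ with $s(\eta)=t(\zeta)$; $\mathrm{Char}(\mathcal{D})$ is the $k$-space of all characters on $\mathcal{D}$. *)

theory Defs
  imports Complex_Main "HOL-Library.Poly_Mapping" "HOL-Library.Function_Algebras"
begin

section \<open>Finite categories\<close>

text \<open>\<open>cmp C g f\<close> is the composite \<open>g \<circ> f\<close>; it is meaningful only
  for morphisms with \<open>src C g = tgt C f\<close>.\<close>

record ('o, 'm) cat =
  obj :: "'o set"
  mor :: "'m set"
  src :: "'m \<Rightarrow> 'o"
  tgt :: "'m \<Rightarrow> 'o"
  idm :: "'o \<Rightarrow> 'm"
  cmp :: "'m \<Rightarrow> 'm \<Rightarrow> 'm"

definition hom_set :: "('o, 'm) cat \<Rightarrow> 'o \<Rightarrow> 'o \<Rightarrow> 'm set" where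
  "hom_set C x y = {f \<in> mor C. src C f = x \<and> tgt C f = y}"

abbreviation end_set :: "('o, 'm) cat \<Rightarrow> 'o \<Rightarrow> 'm set" where
  "end_set C x \<equiv> hom_set C x x"

locale category =
  fixes C :: "('o, 'm) cat"
  assumes src_in: "f \<in> mor C \<Longrightarrow> src C f \<in> obj C"
    and tgt_in: "f \<in> mor C \<Longrightarrow> tgt C f \<in> obj C"
    and idm_in: "x \<in> obj C \<Longrightarrow> idm C x \<in> hom_set C x x"
    and cmp_in: "f \<in> hom_set C x y \<Longrightarrow> g \<in> hom_set C y z \<Longrightarrow> cmp C g f \<in> hom_set C x z"
    and cmp_idm_right: "f \<in> hom_set C x y \<Longrightarrow> cmp C f (idm C x) = f"
    and cmp_idm_left: "f \<in> hom_set C x y \<Longrightarrow> cmp C (idm C y) f = f"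
    and cmp_assoc: "f \<in> hom_set C w x \<Longrightarrow> g \<in> hom_set C x y \<Longrightarrow> h \<in> hom_set C y z \<Longrightarrow>
      cmp C (cmp C h g) f = cmp C h (cmp C g f)"

locale finite_category = category +
  assumes finite_obj: "finite (obj C)"
    and finite_hom: "x \<in> obj C \<Longrightarrow> y \<in> obj C \<Longrightarrow> finite (hom_set C x y)"

definition left_deterministic :: "('o, 'm) cat \<Rightarrow> bool" where
  "left_deterministic C \<longleftrightarrow> (\<forall>x1 \<in> obj C. \<forall>x2 \<in> obj C.
     \<forall>g \<in> hom_set C x1 x2. \<forall>b \<in> end_set C x2. \<exists>a \<in> end_set C x1. cmp C g a = cmp C b g)"

definition right_deterministic :: "('o, 'm) cat \<Rightarrow> bool" where
  "right_deterministic C \<longleftrightarrow> (\<forall>x1 \<in> obj C. \<forall>x2 \<in> obj C.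
     \<forall>g \<in> hom_set C x1 x2. \<forall>a \<in> end_set C x1. \<exists>b \<in> end_set C x2. cmp C g a = cmp C b g)"

definition deterministic :: "('o, 'm) cat \<Rightarrow> bool" where
  "deterministic C \<longleftrightarrow> left_deterministic C \<and> right_deterministic C"

definition cancellative :: "('o, 'm) cat \<Rightarrow> bool" where
  "cancellative C \<longleftrightarrow> (\<forall>x \<in> obj C. \<forall>y \<in> obj C. \<forall>z \<in> obj C.
     (\<forall>g \<in> hom_set C y z. \<forall>f \<in> hom_set C x y. \<forall>f' \<in> hom_set C x y.
        cmp C g f = cmp C g f' \<longrightarrow> f = f') \<and>
     (\<forall>f \<in> hom_set C x y. \<forall>g \<in> hom_set C y z. \<forall>g' \<in> hom_set C y z.
        cmp C g f = cmp C g' f \<longrightarrow> g = g'))"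

definition rr_transitive :: "('o, 'm) cat \<Rightarrow> bool" where
  "rr_transitive C \<longleftrightarrow> (\<forall>x1 \<in> obj C. \<forall>x2 \<in> obj C.
     \<forall>f \<in> hom_set C x1 x2. \<forall>g \<in> hom_set C x1 x2. \<exists>a \<in> end_set C x1. cmp C g a = f)"


section \<open>The adjoint category\<close>

text \<open>A morphism of the adjoint category from \<open>a\<close> to \<open>b\<close> given by \<open>g\<close> is encoded as the
  triple \<open>(a, g, b)\<close>, since the same \<open>g\<close> may be a morphism between different pairs of
  endomorphisms.\<close>

definition adjoint_cat :: "('o, 'm) cat \<Rightarrow> ('m, 'm \<times> 'm \<times> 'm) cat" where
  "adjoint_cat C =
    \<lparr> obj = (\<Union>x \<in> obj C. end_set C x),
      mor = {(a, g, b). \<exists>x1 \<in> obj C. \<exists>x2 \<in> obj C.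
               a \<in> end_set C x1 \<and> b \<in> end_set C x2 \<and> g \<in> hom_set C x1 x2 \<and>
               cmp C g a = cmp C b g},
      src = (\<lambda>(a, g, b). a),
      tgt = (\<lambda>(a, g, b). b),
      idm = (\<lambda>a. (a, idm C (src C a), a)),
      cmp = (\<lambda>(b', h, c) (a, g, b). (a, cmp C h g, c)) \<rparr>"

lemma (in category) mor_adjoint_iff:
  "(a, g, b) \<in> mor (adjoint_cat C) \<longleftrightarrow>
     g \<in> mor C \<and> a \<in> end_set C (src C g) \<and> b \<in> end_set C (tgt C g) \<and> cmp C g a = cmp C b g"
  using src_in tgt_in by (auto simp: adjoint_cat_def hom_set_def)

lemma (in category) category_adjoint: "category (adjoint_cat C)"
proof
  fix f assume "f \<in> mor (adjoint_cat C)"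
  then show "src (adjoint_cat C) f \<in> obj (adjoint_cat C)"
    by (auto simp: adjoint_cat_def)
next
  fix f assume "f \<in> mor (adjoint_cat C)"
  then show "tgt (adjoint_cat C) f \<in> obj (adjoint_cat C)"
    by (auto simp: adjoint_cat_def)
next
  fix a assume "a \<in> obj (adjoint_cat C)"
  then obtain x where x: "x \<in> obj C" "a \<in> end_set C x"
    by (auto simp: adjoint_cat_def)
  moreover have "src C a = x"
    using x by (simp add: hom_set_def)
  ultimately show "idm (adjoint_cat C) a \<in> hom_set (adjoint_cat C) a a"
    using idm_in[of x] cmp_idm_left[of a x x] cmp_idm_right[of a x x]
    by (auto simp: hom_set_def adjoint_cat_def)
next
  fix F G a b c
  assume F: "F \<in> hom_set (adjoint_cat C) a b" and G: "G \<in> hom_set (adjoint_cat C) b c"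
  obtain g where g: "F = (a, g, b)" "(a, g, b) \<in> mor (adjoint_cat C)"
    using F by (cases F) (auto simp: hom_set_def adjoint_cat_def)
  obtain h where h: "G = (b, h, c)" "(b, h, c) \<in> mor (adjoint_cat C)"
    using G by (cases G) (auto simp: hom_set_def adjoint_cat_def)
  obtain x y where 1: "x \<in> obj C" "y \<in> obj C"
      "a \<in> end_set C x" "b \<in> end_set C y" "g \<in> hom_set C x y" "cmp C g a = cmp C b g"
    using g by (auto simp: adjoint_cat_def)
  obtain z where 2: "z \<in> obj C" "c \<in> end_set C z" "h \<in> hom_set C y z" "cmp C h b = cmp C c h"
    using h 1 by (auto simp: adjoint_cat_def hom_set_def)
  have "cmp C (cmp C h g) a = cmp C h (cmp C g a)"
    using cmp_assoc[OF 1(3) 1(5) 2(3)] .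
  also have "\<dots> = cmp C (cmp C h b) g"
    using cmp_assoc[OF 1(5) 1(4) 2(3)] 1(6) by simp
  also have "\<dots> = cmp C c (cmp C h g)"
    using cmp_assoc[OF 1(5) 2(3) 2(2)] 2(4) by simp
  finally have "(a, cmp C h g, c) \<in> mor (adjoint_cat C)"
    using 1 2 cmp_in[OF 1(5) 2(3)] unfolding adjoint_cat_def by auto
  then show "cmp (adjoint_cat C) G F \<in> hom_set (adjoint_cat C) a c"
    by (simp add: g h hom_set_def adjoint_cat_def)
next
  fix F a b assume F: "F \<in> hom_set (adjoint_cat C) a b"
  then obtain x y g where 1: "x \<in> obj C" "y \<in> obj C" "F = (a, g, b)"
      "a \<in> end_set C x" "b \<in> end_set C y" "g \<in> hom_set C x y"
    by (auto simp: hom_set_def[of "adjoint_cat C"]) (auto simp: adjoint_cat_def)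
  have "src C a = x" "src C b = y" using 1 by (auto simp: hom_set_def)
  then show "cmp (adjoint_cat C) F (idm (adjoint_cat C) a) = F"
    and "cmp (adjoint_cat C) (idm (adjoint_cat C) b) F = F"
    using 1 cmp_idm_left[OF 1(6)] cmp_idm_right[OF 1(6)] by (auto simp: adjoint_cat_def)
next
  fix F G H a b c d
  assume F: "F \<in> hom_set (adjoint_cat C) a b" and G: "G \<in> hom_set (adjoint_cat C) b c"
    and H: "H \<in> hom_set (adjoint_cat C) c d"
  obtain f where f: "F = (a, f, b)" "f \<in> mor C" "src C f = src C a" "tgt C f = src C b"
    using F by (auto simp: hom_set_def adjoint_cat_def)
  obtain g where g: "G = (b, g, c)" "g \<in> mor C" "src C g = src C b" "tgt C g = src C c"
    using G by (auto simp: hom_set_def adjoint_cat_def)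
  obtain h where h: "H = (c, h, d)" "h \<in> mor C" "src C h = src C c"
    using H by (auto simp: hom_set_def adjoint_cat_def)
  show "cmp (adjoint_cat C) (cmp (adjoint_cat C) H G) F =
        cmp (adjoint_cat C) H (cmp (adjoint_cat C) G F)"
    using f g h cmp_assoc[of f "src C a" "src C b" g "src C c" h "tgt C h"]
    by (simp add: adjoint_cat_def hom_set_def)
qed

lemma (in finite_category) finite_mor: "finite (mor C)"
proof -
  have "mor C = (\<Union>x \<in> obj C. \<Union>y \<in> obj C. hom_set C x y)"
    using src_in tgt_in by (auto simp: hom_set_def)
  then show ?thesis
    using finite_obj finite_hom by auto
qed

lemma (in finite_category) finite_category_adjoint: "finite_category (adjoint_cat C)"
proof -
  interpret A: category "adjoint_cat C" by (rule category_adjoint)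
  show ?thesis
  proof
    show "finite (obj (adjoint_cat C))"
      using finite_obj finite_hom by (auto simp: adjoint_cat_def)
  next
    fix a b
    have "hom_set (adjoint_cat C) a b \<subseteq> mor C \<times> mor C \<times> mor C"
      by (auto simp: hom_set_def adjoint_cat_def)
    then show "finite (hom_set (adjoint_cat C) a b)"
      using finite_mor by (meson finite_SigmaI finite_subset)
  qed
qed


section \<open>Linear maps between subspaces\<close>

definition linear_on ::
  "('k \<Rightarrow> 'v \<Rightarrow> 'v) \<Rightarrow> ('k \<Rightarrow> 'w \<Rightarrow> 'w) \<Rightarrow> 'v::plus set \<Rightarrow> 'w::plus set \<Rightarrow> ('v \<Rightarrow> 'w) \<Rightarrow> bool" where
  "linear_on s1 s2 V W \<phi> \<longleftrightarrow> \<phi> ` V \<subseteq> W \<and>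
     (\<forall>u \<in> V. \<forall>v \<in> V. \<phi> (u + v) = \<phi> u + \<phi> v) \<and> (\<forall>c. \<forall>u \<in> V. \<phi> (s1 c u) = s2 c (\<phi> u))"

definition linear_iso_on ::
  "('k \<Rightarrow> 'v \<Rightarrow> 'v) \<Rightarrow> ('k \<Rightarrow> 'w \<Rightarrow> 'w) \<Rightarrow> 'v::plus set \<Rightarrow> 'w::plus set \<Rightarrow> ('v \<Rightarrow> 'w) \<Rightarrow> bool" where
  "linear_iso_on s1 s2 V W \<phi> \<longleftrightarrow> linear_on s1 s2 V W \<phi> \<and> bij_betw \<phi> V W"

text \<open>Pointwise scalar multiplication on functions; addition of functions is pointwise by
  \<^theory>\<open>HOL-Library.Function_Algebras\<close>.\<close>

definition fun_scale :: "('k \<Rightarrow> 'v \<Rightarrow> 'v) \<Rightarrow> 'k \<Rightarrow> ('a \<Rightarrow> 'v) \<Rightarrow> 'a \<Rightarrow> 'v" where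
  "fun_scale s c f = (\<lambda>x. s c (f x))"

lemma vector_space_fun_scale:
  assumes "vector_space s"
  shows "vector_space (fun_scale s)"
proof -
  interpret vector_space s by fact
  show ?thesis
    by unfold_locales
      (auto simp: fun_scale_def fun_eq_iff scale_right_distrib scale_left_distrib)
qed


section \<open>The category algebra\<close>

text \<open>The free vector space on a type \<open>'m\<close> is \<open>'m \<Rightarrow>\<^sub>0 'k\<close>, with basis vectors
  \<open>Poly_Mapping.single f 1\<close>. The multiplication that the library puts on this type is not
  the one used here.\<close>

definition pm_scale :: "'k::field \<Rightarrow> ('m \<Rightarrow>\<^sub>0 'k) \<Rightarrow> ('m \<Rightarrow>\<^sub>0 'k)" where
  "pm_scale c = Poly_Mapping.map ((*) c)"

lemma lookup_pm_scale [simp]: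
  "Poly_Mapping.lookup (pm_scale c u) f = c * Poly_Mapping.lookup u f"
  by (simp add: pm_scale_def Poly_Mapping.map.rep_eq when_def)

global_interpretation pm: vector_space "pm_scale :: 'k::field \<Rightarrow> ('m \<Rightarrow>\<^sub>0 'k) \<Rightarrow> ('m \<Rightarrow>\<^sub>0 'k)"
  by unfold_locales (rule poly_mapping_eqI; simp add: lookup_add algebra_simps)+

abbreviation basis_vec :: "'m \<Rightarrow> ('m \<Rightarrow>\<^sub>0 'k::field)" where
  "basis_vec f \<equiv> Poly_Mapping.single f 1"

definition cat_alg :: "('o, 'm) cat \<Rightarrow> ('m \<Rightarrow>\<^sub>0 'k::field) set" where
  "cat_alg C = pm.span (basis_vec ` mor C)"

text \<open>The bilinear extension of the product of morphisms.\<close>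

definition cat_mult ::
  "('o, 'm) cat \<Rightarrow> ('m \<Rightarrow>\<^sub>0 'k::field) \<Rightarrow> ('m \<Rightarrow>\<^sub>0 'k) \<Rightarrow> ('m \<Rightarrow>\<^sub>0 'k)" where
  "cat_mult C u v =
     (\<Sum>a \<in> Poly_Mapping.keys u. \<Sum>b \<in> Poly_Mapping.keys v.
        pm_scale (Poly_Mapping.lookup u a * Poly_Mapping.lookup v b)
          (if src C a = tgt C b then basis_vec (cmp C a b) else 0))"

lemma cat_mult_eq:
  assumes "finite A" "Poly_Mapping.keys u \<subseteq> A" "finite B" "Poly_Mapping.keys v \<subseteq> B"
  shows "cat_mult C u v = (\<Sum>a \<in> A. \<Sum>b \<in> B.
     pm_scale (Poly_Mapping.lookup u a * Poly_Mapping.lookup v b)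
       (if src C a = tgt C b then basis_vec (cmp C a b) else 0))"
  unfolding cat_mult_def using assms
  by (intro sum.mono_neutral_cong_left)
     (auto simp: in_keys_iff intro!: sum.mono_neutral_cong_left sum.neutral)

lemma cat_mult_add_left: "cat_mult C (u + u') v = cat_mult C u v + cat_mult C u' v"
proof -
  let ?A = "Poly_Mapping.keys u \<union> Poly_Mapping.keys u'" and ?B = "Poly_Mapping.keys v"
  have "Poly_Mapping.keys (u + u') \<subseteq> ?A" by (rule Poly_Mapping.keys_add)
  then show ?thesis
    by (simp add: cat_mult_eq[of ?A _ ?B] lookup_add distrib_right pm.scale_left_distrib
        sum.distrib)
qed

lemma cat_mult_add_right: "cat_mult C u (v + v') = cat_mult C u v + cat_mult C u v'"
proof -
  let ?B = "Poly_Mapping.keys v \<union> Poly_Mapping.keys v'" and ?A = "Poly_Mapping.keys u"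
  have "Poly_Mapping.keys (v + v') \<subseteq> ?B" by (rule Poly_Mapping.keys_add)
  then show ?thesis
    by (simp add: cat_mult_eq[of ?A _ ?B] lookup_add distrib_left pm.scale_left_distrib
        sum.distrib)
qed

lemma cat_mult_scale_left: "cat_mult C (pm_scale c u) v = pm_scale c (cat_mult C u v)"
proof -
  let ?A = "Poly_Mapping.keys u" and ?B = "Poly_Mapping.keys v"
  have "Poly_Mapping.keys (pm_scale c u) \<subseteq> ?A" by (auto simp: in_keys_iff)
  then show ?thesis
    by (simp add: cat_mult_eq[of ?A _ ?B] pm.scale_sum_right mult.assoc)
qed

lemma cat_mult_scale_right: "cat_mult C u (pm_scale c v) = pm_scale c (cat_mult C u v)"
proof -
  let ?A = "Poly_Mapping.keys u" and ?B = "Poly_Mapping.keys v"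
  have "Poly_Mapping.keys (pm_scale c v) \<subseteq> ?B" by (auto simp: in_keys_iff)
  then show ?thesis
    by (simp add: cat_mult_eq[of ?A _ ?B] pm.scale_sum_right mult.left_commute)
qed

lemma cat_mult_zero [simp]: "cat_mult C 0 v = 0" "cat_mult C u 0 = 0"
  by (simp_all add: cat_mult_def)

lemma cat_mult_basis:
  "cat_mult C (basis_vec a) (basis_vec b :: 'm \<Rightarrow>\<^sub>0 'k::field) =
     (if src C a = tgt C b then basis_vec (cmp C a b) else 0)"
  by (simp add: cat_mult_def)


section \<open>Graded derivations\<close>

text \<open>The extra element \<open>(0, 0)\<close> of the index set is encoded as \<open>None\<close>.\<close>

definition grading_set :: "('o, 'm) cat \<Rightarrow> ('o \<times> 'o) option set" where
  "grading_set C =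
     Some ` {(x1, x2). x1 \<in> obj C \<and> x2 \<in> obj C \<and> hom_set C x1 x2 \<noteq> {}} \<union> {None}"

fun grading_comp :: "('o, 'm) cat \<Rightarrow> ('o \<times> 'o) option \<Rightarrow> ('m \<Rightarrow>\<^sub>0 'k::field) set" where
  "grading_comp C (Some (x1, x2)) = pm.span (basis_vec ` hom_set C x1 x2)"
| "grading_comp C None = {0}"

definition graded_map :: "('o, 'm) cat \<Rightarrow> (('m \<Rightarrow>\<^sub>0 'k::field) \<Rightarrow> ('m \<Rightarrow>\<^sub>0 'k)) \<Rightarrow> bool" where
  "graded_map C X \<longleftrightarrow> (\<forall>s \<in> grading_set C. X ` grading_comp C s \<subseteq> grading_comp C s)"

text \<open>Maps defined on a set (here the category algebra, and below the morphisms of a category)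
  are represented by total functions that vanish outside that set, so that the representation
  is unique and compatible with pointwise addition and scaling.\<close>

definition graded_der :: "('o, 'm) cat \<Rightarrow> (('m \<Rightarrow>\<^sub>0 'k::field) \<Rightarrow> ('m \<Rightarrow>\<^sub>0 'k)) set" where
  "graded_der C = {X.
     linear_on pm_scale pm_scale (cat_alg C) (cat_alg C) X \<and>
     (\<forall>u \<in> cat_alg C. \<forall>v \<in> cat_alg C.
        X (cat_mult C u v) = cat_mult C (X u) v + cat_mult C u (X v)) \<and>
     graded_map C X \<and>
     (\<forall>u. u \<notin> cat_alg C \<longrightarrow> X u = 0)}"

lemma subspace_grading_comp: "pm.subspace (grading_comp C s :: ('m \<Rightarrow>\<^sub>0 'k::field) set)"
  by (cases "(C, s)" rule: grading_comp.cases) auto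

lemma subspace_graded_der:
  "module.subspace (fun_scale pm_scale)
     (graded_der C :: (('m \<Rightarrow>\<^sub>0 'k::field) \<Rightarrow> ('m \<Rightarrow>\<^sub>0 'k)) set)"
proof -
  interpret F: vector_space
    "fun_scale pm_scale :: 'k \<Rightarrow> (('m \<Rightarrow>\<^sub>0 'k) \<Rightarrow> ('m \<Rightarrow>\<^sub>0 'k)) \<Rightarrow> _"
    by (rule vector_space_fun_scale) (rule pm.vector_space_axioms)
  have A: "pm.subspace (cat_alg C :: ('m \<Rightarrow>\<^sub>0 'k) set)"
    by (simp add: cat_alg_def)
  note sub = pm.subspace_0 pm.subspace_add pm.subspace_scale
  show ?thesis
  proof (rule F.subspaceI)
    show "0 \<in> (graded_der C :: (('m \<Rightarrow>\<^sub>0 'k) \<Rightarrow> ('m \<Rightarrow>\<^sub>0 'k)) set)"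
      using sub(1)[OF A] sub(1)[OF subspace_grading_comp]
      by (auto simp: graded_der_def linear_on_def graded_map_def)
  next
    fix X Y :: "('m \<Rightarrow>\<^sub>0 'k) \<Rightarrow> ('m \<Rightarrow>\<^sub>0 'k)"
    assume "X \<in> graded_der C" "Y \<in> graded_der C"
    then show "X + Y \<in> graded_der C"
      by (auto intro!: sub(2)[OF A] sub(2)[OF subspace_grading_comp] simp: graded_der_def linear_on_def graded_map_def image_subset_iff
          cat_mult_add_left cat_mult_add_right pm.scale_right_distrib)
  next
    fix c :: 'k and X :: "('m \<Rightarrow>\<^sub>0 'k) \<Rightarrow> ('m \<Rightarrow>\<^sub>0 'k)"
    assume "X \<in> graded_der C"
    then show "fun_scale pm_scale c X \<in> graded_der C"
      by (auto intro!: sub(3)[OF A] sub(3)[OF subspace_grading_comp] simp: graded_der_def linear_on_def graded_map_def image_subset_iff fun_scale_def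
          cat_mult_scale_left cat_mult_scale_right pm.scale_right_distrib mult.commute)
  qed
qed


section \<open>Characters\<close>

definition characters :: "('o, 'm) cat \<Rightarrow> ('m \<Rightarrow> 'k::field) set" where
  "characters D = {T.
     (\<forall>\<eta> \<in> mor D. \<forall>\<zeta> \<in> mor D. src D \<eta> = tgt D \<zeta> \<longrightarrow> T (cmp D \<eta> \<zeta>) = T \<eta> + T \<zeta>) \<and>
     (\<forall>\<eta>. \<eta> \<notin> mor D \<longrightarrow> T \<eta> = 0)}"

lemma subspace_characters:
  assumes "category D"
  shows "module.subspace (fun_scale (*)) (characters D :: ('m \<Rightarrow> 'k::field) set)"
proof -
  interpret category D by fact
  interpret F: vector_space "fun_scale (*) :: 'k \<Rightarrow> ('m \<Rightarrow> 'k) \<Rightarrow> 'm \<Rightarrow> 'k"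
    by (rule vector_space_fun_scale) (unfold_locales; simp add: algebra_simps)
  show ?thesis
    by (rule F.subspaceI) (auto simp: characters_def fun_scale_def algebra_simps)
qed

end

theory Submission
  imports Defs
begin

text \<open>
  Graded derivations are determined by their matrix entries, and the isomorphism sends \<open>X\<close> to
  \<open>(a, g, b) \<mapsto>\<close> the coefficient of \<open>g \<circ> a = b \<circ> g\<close> in \<open>X g\<close>. For \<open>(a, g, b)\<close> and
  \<open>(b, h, c)\<close> the coefficient of \<open>h \<circ> g \<circ> a = h \<circ> b \<circ> g\<close> in \<open>X (h \<circ> g) = X h \<circ> g + h \<circ> X g\<close>
  is, by cancellation, the coefficient of \<open>h \<circ> b\<close> in \<open>X h\<close> plus that of \<open>g \<circ> a\<close> in \<open>X g\<close>;
  this is additivity of the character. Conversely, by rr-transitivity, determinism and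
  cancellation every \<open>k\<close> parallel to \<open>g\<close> is \<open>g \<circ> a = b \<circ> g\<close> for exactly one pair \<open>(a, b)\<close>,
  so a character prescribes all matrix entries, and the same computation read backwards gives
  the Leibniz rule.
\<close>

section \<open>Supports, spans and coefficients of products\<close>

text \<open>A vector is the sum of its coefficients times basis vectors, and sums and multiples
  create no new support. Gradedness thereby becomes an inclusion of supports.\<close>

lemma span_basis_iff:
  "(u :: 'm \<Rightarrow>\<^sub>0 'k::field) \<in> pm.span (basis_vec ` A) \<longleftrightarrow> Poly_Mapping.keys u \<subseteq> A"
proof
  assume "u \<in> pm.span (basis_vec ` A)"
  then show "Poly_Mapping.keys u \<subseteq> A"
  proof (rule pm.span_induct)
    show "pm.subspace {u :: 'm \<Rightarrow>\<^sub>0 'k. Poly_Mapping.keys u \<subseteq> A}"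
      by (rule pm.subspaceI) (auto simp: in_keys_iff subset_iff lookup_add, metis add_0)
  qed auto
next
  assume K: "Poly_Mapping.keys u \<subseteq> A"
  have "u = (\<Sum>a \<in> Poly_Mapping.keys u. pm_scale (Poly_Mapping.lookup u a) (basis_vec a))"
    by (rule poly_mapping_eqI)
      (simp add: lookup_sum lookup_single when_def if_distrib sum.delta in_keys_iff cong: if_cong)
  also have "\<dots> \<in> pm.span (basis_vec ` A)"
    using K by (intro pm.span_sum pm.span_scale pm.span_base) auto
  finally show "u \<in> pm.span (basis_vec ` A)" .
qed

lemma cat_alg_iff: "u \<in> cat_alg C \<longleftrightarrow> Poly_Mapping.keys u \<subseteq> mor C"
  by (simp add: cat_alg_def span_basis_iff)

text \<open>The points where the two maps agree form a subspace. Linearity is only available on the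
  span, so membership in it is carried through the induction.\<close>

lemma linear_on_span_cong:
  fixes X Y :: "('m \<Rightarrow>\<^sub>0 'k::field) \<Rightarrow> ('m \<Rightarrow>\<^sub>0 'k)"
  assumes X: "linear_on pm_scale pm_scale (pm.span B) W X"
    and Y: "linear_on pm_scale pm_scale (pm.span B) W Y"
    and eq: "\<And>x. x \<in> B \<Longrightarrow> X x = Y x"
    and u: "u \<in> pm.span B"
  shows "X u = Y u"
proof -
  \<comment> \<open>\<open>linear_on\<close> speaks only of sums and scalar multiples, so the value
    at zero comes from scaling by zero.\<close>
  have z: "X 0 = 0" if "linear_on pm_scale pm_scale (pm.span B) W X"
    for X :: "('m \<Rightarrow>\<^sub>0 'k) \<Rightarrow> ('m \<Rightarrow>\<^sub>0 'k)"
  proof -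
    have "X (pm_scale 0 0) = pm_scale 0 (X 0)"
      using that pm.span_zero unfolding linear_on_def by blast
    then show ?thesis by simp
  qed
  have "u \<in> pm.span B \<and> X u = Y u"
    using u
  proof (rule pm.span_induct)
    show "pm.subspace {u. u \<in> pm.span B \<and> X u = Y u}"
      using X Y z[OF X] z[OF Y]
      by (intro pm.subspaceI)
        (auto simp: linear_on_def intro: pm.span_zero pm.span_add pm.span_scale)
  qed (simp add: pm.span_base eq)
  then show ?thesis by simp
qed

text \<open>Right composition with \<open>g\<close> is injective on the support of \<open>u\<close>,
  so no two terms collide and only \<open>h\<close> contributes to this coefficient.\<close>

lemma lookup_cat_mult_basis_right:
  assumes inj: "\<And>f f'. f \<in> A \<Longrightarrow> f' \<in> A \<Longrightarrow> cmp C f g = cmp C f' g \<Longrightarrow> f = f'"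
    and A: "\<And>f. f \<in> A \<Longrightarrow> src C f = tgt C g"
    and u: "Poly_Mapping.keys u \<subseteq> A" and h: "h \<in> A"
  shows "Poly_Mapping.lookup (cat_mult C u (basis_vec g)) (cmp C h g)
    = Poly_Mapping.lookup (u :: 'm \<Rightarrow>\<^sub>0 'k::field) h"
proof -
  have "Poly_Mapping.lookup (cat_mult C u (basis_vec g)) (cmp C h g) =
      (\<Sum>a \<in> Poly_Mapping.keys u. if a = h then Poly_Mapping.lookup u a else 0)"
  proof -
    have "cmp C a g = cmp C h g \<longleftrightarrow> a = h" if "a \<in> Poly_Mapping.keys u" for a
      using inj[of a h] u h that by (metis subsetD)
    moreover have "src C a = tgt C g" if "a \<in> Poly_Mapping.keys u" for a
      using A u that by (metis subsetD)
    ultimately have *: "Poly_Mapping.lookup (pm_scale (Poly_Mapping.lookup u a)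
        (if src C a = tgt C g then basis_vec (cmp C a g) else 0)) (cmp C h g) =
        (if a = h then Poly_Mapping.lookup u a else 0)" if "a \<in> Poly_Mapping.keys u" for a
      using that by (simp add: lookup_single when_def)
    have "cat_mult C u (basis_vec g) = (\<Sum>a \<in> Poly_Mapping.keys u.
        pm_scale (Poly_Mapping.lookup u a) (if src C a = tgt C g then basis_vec (cmp C a g) else 0))"
      unfolding cat_mult_def keys_single by simp
    then show ?thesis
      by (simp only: lookup_sum) (rule sum.cong[OF refl *])
  qed
  then show ?thesis by (simp add: in_keys_iff)
qed

lemma lookup_cat_mult_basis_left:
  assumes inj: "\<And>f f'. f \<in> A \<Longrightarrow> f' \<in> A \<Longrightarrow> cmp C g f = cmp C g f' \<Longrightarrow> f = f'"
    and A: "\<And>f. f \<in> A \<Longrightarrow> tgt C f = src C g"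
    and u: "Poly_Mapping.keys u \<subseteq> A" and h: "h \<in> A"
  shows "Poly_Mapping.lookup (cat_mult C (basis_vec g) u) (cmp C g h)
    = Poly_Mapping.lookup (u :: 'm \<Rightarrow>\<^sub>0 'k::field) h"
proof -
  have "Poly_Mapping.lookup (cat_mult C (basis_vec g) u) (cmp C g h) =
      (\<Sum>a \<in> Poly_Mapping.keys u. if a = h then Poly_Mapping.lookup u a else 0)"
  proof -
    have "cmp C g a = cmp C g h \<longleftrightarrow> a = h" if "a \<in> Poly_Mapping.keys u" for a
      using inj[of a h] u h that by (metis subsetD)
    moreover have "src C g = tgt C a" if "a \<in> Poly_Mapping.keys u" for a
      using A u that by (metis subsetD)
    ultimately have *: "Poly_Mapping.lookup (pm_scale (Poly_Mapping.lookup u a)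
        (if src C g = tgt C a then basis_vec (cmp C g a) else 0)) (cmp C g h) =
        (if a = h then Poly_Mapping.lookup u a else 0)" if "a \<in> Poly_Mapping.keys u" for a
      using that by (simp add: lookup_single when_def)
    have "cat_mult C (basis_vec g) u = (\<Sum>a \<in> Poly_Mapping.keys u.
        pm_scale (Poly_Mapping.lookup u a) (if src C g = tgt C a then basis_vec (cmp C g a) else 0))"
      unfolding cat_mult_def keys_single by simp
    then show ?thesis
      by (simp only: lookup_sum) (rule sum.cong[OF refl *])
  qed
  then show ?thesis by (simp add: in_keys_iff)
qed

text \<open>Only composable pairs yield a nonzero term. The inclusion can be strict, since
  coefficients of coinciding composites may add up to zero.\<close>

lemma keys_cat_mult:
  fixes u v :: "'m \<Rightarrow>\<^sub>0 'k::field"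
  shows "Poly_Mapping.keys (cat_mult C u v) \<subseteq>
    {cmp C a b |a b. a \<in> Poly_Mapping.keys u \<and> b \<in> Poly_Mapping.keys v \<and> src C a = tgt C b}"
    (is "_ \<subseteq> ?S")
  unfolding span_basis_iff[symmetric] cat_mult_def
  by (intro pm.span_sum pm.span_scale) (auto intro!: pm.span_base pm.span_zero)

section \<open>Adjoint morphisms over a fixed morphism\<close>

locale rr_right_deterministic_category = finite_category C for C :: "('o, 'm) cat" +
  assumes rr_transitive: "rr_transitive C"
    and right_deterministic: "right_deterministic C"
    and cancellative: "cancellative C"
begin

lemma hom_obj: "f \<in> hom_set C x y \<Longrightarrow> x \<in> obj C \<and> y \<in> obj C"
  using src_in tgt_in by (auto simp: hom_set_def)

lemma hom_mor: "f \<in> mor C \<Longrightarrow> f \<in> hom_set C (src C f) (tgt C f)"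
  by (simp add: hom_set_def)

lemma cancel_left:
  "g \<in> hom_set C y z \<Longrightarrow> f \<in> hom_set C x y \<Longrightarrow> f' \<in> hom_set C x y \<Longrightarrow>
    cmp C g f = cmp C g f' \<Longrightarrow> f = f'"
  using cancellative hom_obj unfolding cancellative_def by blast

lemma cancel_right:
  "f \<in> hom_set C x y \<Longrightarrow> g \<in> hom_set C y z \<Longrightarrow> g' \<in> hom_set C y z \<Longrightarrow>
    cmp C g f = cmp C g' f \<Longrightarrow> g = g'"
  using cancellative hom_obj unfolding cancellative_def by blast

lemma adjoint_homs:
  assumes "(a, g, b) \<in> mor (adjoint_cat C)" "g \<in> hom_set C x y"
  shows "a \<in> end_set C x" "b \<in> end_set C y" "cmp C g a = cmp C b g" "cmp C g a \<in> hom_set C x y"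
proof -
  show a: "a \<in> end_set C x" and "b \<in> end_set C y" and "cmp C g a = cmp C b g"
    using assms by (auto simp: mor_adjoint_iff hom_set_def)
  show "cmp C g a \<in> hom_set C x y"
    using cmp_in[OF a assms(2)] .
qed

text \<open>Cancelling \<open>g\<close> on the left identifies \<open>a\<close> with
  \<open>a'\<close>; cancelling it on the right in \<open>b \<circ> g = b' \<circ> g\<close>
  identifies \<open>b\<close> with \<open>b'\<close>.\<close>

lemma adjoint_unique:
  assumes p: "(a, g, b) \<in> mor (adjoint_cat C)" and q: "(a', g, b') \<in> mor (adjoint_cat C)"
    and eq: "cmp C g a = cmp C g a'"
  shows "a = a'" "b = b'"
proof -
  have g: "g \<in> hom_set C (src C g) (tgt C g)"
    using p by (simp add: mor_adjoint_iff hom_set_def)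
  note P = adjoint_homs[OF p g] and Q = adjoint_homs[OF q g]
  show "a = a'"
    using cancel_left[OF g P(1) Q(1) eq] .
  show "b = b'"
    using cancel_right[OF g P(2) Q(2)] P(3) Q(3) eq by simp
qed

text \<open>Transitivity provides \<open>a\<close>, and right determinism moves it across
  \<open>g\<close> to give \<open>b\<close>. With \<open>adjoint_unique\<close>, the adjoint
  morphisms over \<open>g\<close> correspond bijectively to the morphisms parallel to
  \<open>g\<close>.\<close>

lemma adjoint_exists:
  assumes "g \<in> hom_set C x y" "k \<in> hom_set C x y"
  obtains a b where "(a, g, b) \<in> mor (adjoint_cat C)" "k = cmp C g a"
proof -
  have xy: "x \<in> obj C" "y \<in> obj C"
    using hom_obj assms by blast+
  obtain a where a: "a \<in> end_set C x" "cmp C g a = k"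
    using rr_transitive xy assms unfolding rr_transitive_def by blast
  obtain b where b: "b \<in> end_set C y" "cmp C g a = cmp C b g"
    using right_deterministic xy assms(1) a(1) unfolding right_deterministic_def by blast
  have "(a, g, b) \<in> mor (adjoint_cat C)"
    using assms(1) a b by (simp add: mor_adjoint_iff hom_set_def)
  then show thesis using that a by blast
qed

text \<open>\<open>D g\<close> plays the role of \<open>X g\<close>: the Leibniz rule on a composable pair, read off at the
  coefficient of \<open>h \<circ> g \<circ> a\<close>, is the additivity of the associated character.\<close>

lemma lookup_leibniz:
  fixes D :: "'m \<Rightarrow> ('m \<Rightarrow>\<^sub>0 'k::field)"
  assumes p: "(a, g, b) \<in> mor (adjoint_cat C)" and q: "(b, h, c) \<in> mor (adjoint_cat C)"
    and g: "g \<in> hom_set C x y" and h: "h \<in> hom_set C y z"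
    and Dg: "Poly_Mapping.keys (D g) \<subseteq> hom_set C x y"
    and Dh: "Poly_Mapping.keys (D h) \<subseteq> hom_set C y z"
  shows "Poly_Mapping.lookup (cat_mult C (D h) (basis_vec g) + cat_mult C (basis_vec h) (D g))
      (cmp C (cmp C h g) a) =
    Poly_Mapping.lookup (D h) (cmp C h b) + Poly_Mapping.lookup (D g) (cmp C g a)"
proof -
  note P = adjoint_homs[OF p g] and Q = adjoint_homs[OF q h]
  have 1: "cmp C (cmp C h g) a = cmp C h (cmp C g a)"
    using cmp_assoc[OF P(1) g h] .
  \<comment> \<open>Each summand needs its own factorization of the same morphism: one ending in
    \<open>g\<close>, the other starting with \<open>h\<close>. The relation
    \<open>g \<circ> a = b \<circ> g\<close> links them.\<close>
  have 2: "cmp C (cmp C h g) a = cmp C (cmp C h b) g"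
    using 1 P(3) cmp_assoc[OF g P(2) h] by simp
  have "Poly_Mapping.lookup (cat_mult C (D h) (basis_vec g)) (cmp C (cmp C h b) g) =
      Poly_Mapping.lookup (D h) (cmp C h b)"
    by (rule lookup_cat_mult_basis_right[OF cancel_right[OF g] _ Dh Q(4)])
      (use g in \<open>auto simp: hom_set_def\<close>)
  moreover have "Poly_Mapping.lookup (cat_mult C (basis_vec h) (D g)) (cmp C h (cmp C g a)) =
      Poly_Mapping.lookup (D g) (cmp C g a)"
    by (rule lookup_cat_mult_basis_left[OF cancel_left[OF h] _ Dg P(4)])
      (use h in \<open>auto simp: hom_set_def\<close>)
  ultimately show ?thesis
    unfolding lookup_add using 1 2 by metis
qed

section \<open>From graded derivations to characters\<close>

lemma graded_der_keys:
  fixes X :: "('m \<Rightarrow>\<^sub>0 'k::field) \<Rightarrow> ('m \<Rightarrow>\<^sub>0 'k)"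
  assumes X: "X \<in> graded_der C" and g: "g \<in> hom_set C x y"
  shows "Poly_Mapping.keys (X (basis_vec g)) \<subseteq> hom_set C x y"
proof -
  have "Some (x, y) \<in> grading_set C"
    using hom_obj[OF g] g by (auto simp: grading_set_def)
  then have "X ` pm.span (basis_vec ` hom_set C x y) \<subseteq> pm.span (basis_vec ` hom_set C x y)"
    using X by (force simp: graded_der_def graded_map_def)
  moreover have "(basis_vec g :: 'm \<Rightarrow>\<^sub>0 'k) \<in> pm.span (basis_vec ` hom_set C x y)"
    using g by (intro pm.span_base) auto
  ultimately show ?thesis
    by (auto simp: span_basis_iff image_subset_iff)
qed

text \<open>The endomorphism \<open>b\<close> enters only through membership; the value 0 elsewhere
  is the convention of \<open>characters\<close>.\<close>

definition der_char :: "(('m \<Rightarrow>\<^sub>0 'k::field) \<Rightarrow> ('m \<Rightarrow>\<^sub>0 'k)) \<Rightarrow> 'm \<times> 'm \<times> 'm \<Rightarrow> 'k" where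
  "der_char X = (\<lambda>(a, g, b). if (a, g, b) \<in> mor (adjoint_cat C)
     then Poly_Mapping.lookup (X (basis_vec g)) (cmp C g a) else 0)"

lemma der_char_apply:
  "(a, g, b) \<in> mor (adjoint_cat C) \<Longrightarrow>
    der_char X (a, g, b) = Poly_Mapping.lookup (X (basis_vec g)) (cmp C g a)"
  by (simp add: der_char_def)

lemma der_char_character:
  fixes X :: "('m \<Rightarrow>\<^sub>0 'k::field) \<Rightarrow> ('m \<Rightarrow>\<^sub>0 'k)"
  assumes X: "X \<in> graded_der C"
  shows "der_char X \<in> characters (adjoint_cat C)"
proof -
  interpret A: category "adjoint_cat C" by (rule category_adjoint)
  have "der_char X (cmp (adjoint_cat C) \<eta> \<zeta>) = der_char X \<eta> + der_char X \<zeta>"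
    if \<eta>\<zeta>: "\<eta> \<in> mor (adjoint_cat C)" "\<zeta> \<in> mor (adjoint_cat C)"
      "src (adjoint_cat C) \<eta> = tgt (adjoint_cat C) \<zeta>" for \<eta> \<zeta>
  proof -
    obtain a g b where \<zeta>: "\<zeta> = (a, g, b)" by (cases \<zeta>)
    obtain h c where \<eta>: "\<eta> = (b, h, c)"
      using \<eta>\<zeta>(3) \<zeta> by (cases \<eta>) (auto simp: adjoint_cat_def)
    note p = \<eta>\<zeta>(2)[unfolded \<zeta>] and q = \<eta>\<zeta>(1)[unfolded \<eta>]
    define x y z where "x = src C g" and "y = tgt C g" and "z = tgt C h"
    have g: "g \<in> hom_set C x y"
      using p by (simp add: mor_adjoint_iff hom_set_def x_def y_def)
    have h: "h \<in> hom_set C y z"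
      using p q by (auto simp: mor_adjoint_iff hom_set_def y_def z_def)
    have c: "cmp (adjoint_cat C) \<eta> \<zeta> = (a, cmp C h g, c)"
      by (simp add: \<eta> \<zeta> adjoint_cat_def)
    \<comment> \<open>This rules out the default value 0 of \<open>der_char\<close> at the
      composite.\<close>
    have hg: "(a, cmp C h g, c) \<in> mor (adjoint_cat C)"
      using A.cmp_in[of \<zeta> a b \<eta> c] \<eta>\<zeta> c
      by (simp add: \<eta> \<zeta> hom_set_def) (simp add: adjoint_cat_def)
    have alg: "(basis_vec g :: 'm \<Rightarrow>\<^sub>0 'k) \<in> cat_alg C" "(basis_vec h :: 'm \<Rightarrow>\<^sub>0 'k) \<in> cat_alg C"
      using g h by (auto simp: cat_alg_iff hom_set_def)
    have "X (cat_mult C (basis_vec h) (basis_vec g)) =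
        cat_mult C (X (basis_vec h)) (basis_vec g) + cat_mult C (basis_vec h) (X (basis_vec g))"
      using X alg by (simp add: graded_der_def)
    moreover have "src C h = tgt C g"
      using g h by (simp add: hom_set_def)
    ultimately have "X (basis_vec (cmp C h g)) =
        cat_mult C (X (basis_vec h)) (basis_vec g) + cat_mult C (basis_vec h) (X (basis_vec g))"
      by (simp add: cat_mult_basis)
    then show ?thesis
      using lookup_leibniz[OF p q g h graded_der_keys[OF X g] graded_der_keys[OF X h]]
      unfolding c unfolding \<eta> \<zeta>
      by (simp add: der_char_apply[OF p] der_char_apply[OF q] der_char_apply[OF hg])
  qed
  then show ?thesis
    by (auto simp: characters_def der_char_def)
qed

text \<open>By \<open>adjoint_exists\<close> the character records every coefficient of
  \<open>X g\<close> at a morphism parallel to \<open>g\<close>; all others vanish by gradedness.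
  Linearity then fixes \<open>X\<close> on the algebra, and outside it \<open>X\<close> is 0 by
  convention.\<close>

lemma der_char_inj: "inj_on der_char (graded_der C :: (('m \<Rightarrow>\<^sub>0 'k::field) \<Rightarrow> ('m \<Rightarrow>\<^sub>0 'k)) set)"
proof (rule inj_onI)
  fix X Y :: "('m \<Rightarrow>\<^sub>0 'k) \<Rightarrow> ('m \<Rightarrow>\<^sub>0 'k)"
  assume X: "X \<in> graded_der C" and Y: "Y \<in> graded_der C" and eq: "der_char X = der_char Y"
  have basis: "X (basis_vec g) = Y (basis_vec g)" if "g \<in> mor C" for g
  proof (rule poly_mapping_eqI)
    fix k
    note g = hom_mor[OF that]
    show "Poly_Mapping.lookup (X (basis_vec g)) k = Poly_Mapping.lookup (Y (basis_vec g)) k"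
    proof (cases "k \<in> hom_set C (src C g) (tgt C g)")
      case True
      then obtain a b where "(a, g, b) \<in> mor (adjoint_cat C)" "k = cmp C g a"
        using adjoint_exists[OF g] by blast
      then show ?thesis
        using eq by (metis der_char_apply)
    next
      case False
      then show ?thesis
        using graded_der_keys[OF X g] graded_der_keys[OF Y g] by (metis in_keys_iff subsetD)
    qed
  qed
  show "X = Y"
  proof
    fix u
    show "X u = Y u"
    proof (cases "u \<in> cat_alg C")
      case True
      then show ?thesis
        using X Y basis linear_on_span_cong[of "basis_vec ` mor C" "cat_alg C" X Y u]
        by (auto simp: graded_der_def cat_alg_def)
    next
      case False
      then show ?thesis using X Y by (simp add: graded_der_def)
    qed
  qed
qed

section \<open>From characters to graded derivations\<close>

text \<open>The value on \<open>g\<close> of the derivation with character \<open>T\<close>. Summing over morphisms of the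
  adjoint category avoids choosing, for each \<open>k\<close> parallel to \<open>g\<close>, the pair \<open>(a, b)\<close> with
  \<open>k = g \<circ> a = b \<circ> g\<close>.\<close>

definition char_vec :: "('m \<times> 'm \<times> 'm \<Rightarrow> 'k::field) \<Rightarrow> 'm \<Rightarrow> ('m \<Rightarrow>\<^sub>0 'k)" where
  "char_vec T g = (\<Sum>(a, g', b) \<in> {p \<in> mor (adjoint_cat C). fst (snd p) = g}.
     pm_scale (T (a, g', b)) (basis_vec (cmp C g a)))"

lemma lookup_char_vec:
  assumes p: "(a, g, b) \<in> mor (adjoint_cat C)"
  shows "Poly_Mapping.lookup (char_vec T g) (cmp C g a) = T (a, g, b)"
proof -
  interpret A: finite_category "adjoint_cat C" by (rule finite_category_adjoint)
  let ?P = "{p \<in> mor (adjoint_cat C). fst (snd p) = g}"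
  have "Poly_Mapping.lookup (char_vec T g) (cmp C g a) =
      (\<Sum>q \<in> ?P. if q = (a, g, b) then T q else 0)"
    unfolding char_vec_def lookup_sum
  proof (rule sum.cong)
    fix q assume q: "q \<in> ?P"
    then obtain a' b' where q': "q = (a', g, b')" "(a', g, b') \<in> mor (adjoint_cat C)"
      by (cases q) auto
    \<comment> \<open>Distinct adjoint morphisms over \<open>g\<close> have distinct composites, so
      a single summand survives.\<close>
    have "cmp C g a' = cmp C g a \<longleftrightarrow> q = (a, g, b)"
      using adjoint_unique[OF q'(2) p] q'(1) by blast
    then show "Poly_Mapping.lookup (case q of (a, g', b) \<Rightarrow>
        pm_scale (T (a, g', b)) (basis_vec (cmp C g a))) (cmp C g a) =
        (if q = (a, g, b) then T q else 0)"
      by (simp add: q'(1) lookup_single when_def)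
  qed simp
  also have "\<dots> = T (a, g, b)"
    using p A.finite_mor by simp
  finally show ?thesis .
qed

lemma keys_char_vec:
  assumes "g \<in> hom_set C x y"
  shows "Poly_Mapping.keys (char_vec T g) \<subseteq> hom_set C x y"
  unfolding span_basis_iff[symmetric] char_vec_def
proof (rule pm.span_sum)
  fix q assume "q \<in> {p \<in> mor (adjoint_cat C). fst (snd p) = g}"
  then obtain a b where "q = (a, g, b)" "(a, g, b) \<in> mor (adjoint_cat C)"
    by (cases q) auto
  then show "(case q of (a, g', b) \<Rightarrow> pm_scale (T (a, g', b)) (basis_vec (cmp C g a)))
      \<in> pm.span (basis_vec ` hom_set C x y)"
    using adjoint_homs(4)[OF _ assms] by (simp add: pm.span_scale pm.span_base)
qed

text \<open>Summing over the finite set \<open>mor C\<close> instead of the support of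
  \<open>u\<close> makes linearity immediate; coordinates outside \<open>mor C\<close> are
  ignored.\<close>

definition char_lin :: "('m \<times> 'm \<times> 'm \<Rightarrow> 'k::field) \<Rightarrow> ('m \<Rightarrow>\<^sub>0 'k) \<Rightarrow> ('m \<Rightarrow>\<^sub>0 'k)" where
  "char_lin T u = (\<Sum>g \<in> mor C. pm_scale (Poly_Mapping.lookup u g) (char_vec T g))"

lemma char_lin_add: "char_lin T (u + v) = char_lin T u + char_lin T v"
  by (simp add: char_lin_def lookup_add pm.scale_left_distrib sum.distrib)

lemma char_lin_scale: "char_lin T (pm_scale c u) = pm_scale c (char_lin T u)"
  by (simp add: char_lin_def pm.scale_sum_right)

lemma char_lin_zero [simp]: "char_lin T 0 = 0"
  by (simp add: char_lin_def)

lemma char_lin_basis: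
  assumes "g \<in> mor C"
  shows "char_lin T (basis_vec g) = char_vec T g"
proof -
  have "char_lin T (basis_vec g) = (\<Sum>h \<in> mor C. if h = g then char_vec T g else 0)"
    unfolding char_lin_def by (rule sum.cong) (auto simp: lookup_single when_def)
  then show ?thesis
    using assms finite_mor by simp
qed

text \<open>For a composable pair, coefficients are compared at each \<open>k\<close> parallel to
  \<open>h \<circ> g\<close>: the adjoint morphism over \<open>h \<circ> g\<close> giving
  \<open>k\<close> is split into one over \<open>g\<close> followed by one over \<open>h\<close>,
  and \<open>T\<close> is additive.\<close>

lemma char_lin_leibniz_basis:
  fixes T :: "'m \<times> 'm \<times> 'm \<Rightarrow> 'k::field"
  assumes T: "T \<in> characters (adjoint_cat C)" and h: "h \<in> mor C" and g: "g \<in> mor C"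
  shows "char_lin T (cat_mult C (basis_vec h) (basis_vec g)) =
    cat_mult C (char_lin T (basis_vec h)) (basis_vec g) +
    cat_mult C (basis_vec h) (char_lin T (basis_vec g))"
proof -
  note hom = hom_mor[OF g] hom_mor[OF h]
  note K = keys_char_vec[OF hom(1), of T] keys_char_vec[OF hom(2), of T]
  have K': "Poly_Mapping.keys (cat_mult C (char_vec T h) (basis_vec g)) \<subseteq>
      (\<lambda>a. cmp C a g) ` {a \<in> Poly_Mapping.keys (char_vec T h). src C a = tgt C g}"
    using keys_cat_mult[of C "char_vec T h" "basis_vec g"] by auto
  have K'': "Poly_Mapping.keys (cat_mult C (basis_vec h) (char_vec T g)) \<subseteq>
      cmp C h ` {b \<in> Poly_Mapping.keys (char_vec T g). src C h = tgt C b}"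
    using keys_cat_mult[of C "basis_vec h" "char_vec T g"] by auto
  show ?thesis
  proof (cases "src C h = tgt C g")
    case False
    \<comment> \<open>All terms of \<open>char_vec T h\<close> are parallel to \<open>h\<close>,
      hence as little composable with \<open>g\<close> as \<open>h\<close> itself; likewise with the
      roles exchanged.\<close>
    have "{a \<in> Poly_Mapping.keys (char_vec T h). src C a = tgt C g} = {}"
      using K(2) False by (auto simp: hom_set_def)
    moreover have "{b \<in> Poly_Mapping.keys (char_vec T g). src C h = tgt C b} = {}"
      using K(1) False by (auto simp: hom_set_def)
    ultimately have "cat_mult C (char_vec T h) (basis_vec g) = 0"
      "cat_mult C (basis_vec h) (char_vec T g) = 0"
      using K' K'' by (simp_all only: image_empty subset_empty keys_eq_empty)
    then show ?thesis
      using False by (simp add: char_lin_basis g h cat_mult_basis)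
  next
    case True
    define x y z where "x = src C g" and "y = tgt C g" and "z = tgt C h"
    have g': "g \<in> hom_set C x y" and h': "h \<in> hom_set C y z"
      using hom True by (auto simp: x_def y_def z_def)
    have hg: "cmp C h g \<in> hom_set C x z"
      using cmp_in[OF g' h'] .
    then have hg_mor: "cmp C h g \<in> mor C"
      by (simp add: hom_set_def)
    note Kg = keys_char_vec[OF g', of T] and Kh = keys_char_vec[OF h', of T]
    let ?R = "cat_mult C (char_vec T h) (basis_vec g) + cat_mult C (basis_vec h) (char_vec T g)"
    have R: "Poly_Mapping.keys ?R \<subseteq> hom_set C x z"
    proof -
      have "Poly_Mapping.keys (cat_mult C (char_vec T h) (basis_vec g)) \<subseteq> hom_set C x z"
        by (rule subset_trans[OF K']) (auto intro!: cmp_in[OF g' subsetD[OF Kh]])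
      moreover have "Poly_Mapping.keys (cat_mult C (basis_vec h) (char_vec T g)) \<subseteq> hom_set C x z"
        by (rule subset_trans[OF K'']) (auto intro!: cmp_in[OF subsetD[OF Kg] h'])
      ultimately show ?thesis
        by (intro subset_trans[OF Poly_Mapping.keys_add] Un_least)
    qed
    have "char_vec T (cmp C h g) = ?R"
    proof (rule poly_mapping_eqI)
      fix k
      show "Poly_Mapping.lookup (char_vec T (cmp C h g)) k = Poly_Mapping.lookup ?R k"
      proof (cases "k \<in> hom_set C x z")
        case False
        then have "k \<notin> Poly_Mapping.keys (char_vec T (cmp C h g))" "k \<notin> Poly_Mapping.keys ?R"
          using R keys_char_vec[OF hg, of T] by blast+
        then show ?thesis
          by (simp only: in_keys_iff not_not)
      next
        case True
        obtain a c where hga: "(a, cmp C h g, c) \<in> mor (adjoint_cat C)" "k = cmp C (cmp C h g) a"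
          using adjoint_exists[OF hg True] .
        note HG = adjoint_homs[OF hga(1) hg]
        \<comment> \<open>The endomorphism \<open>b\<close> of the middle object is where
          \<open>(a, h \<circ> g, c)\<close> gets split.\<close>
        obtain b where b: "b \<in> end_set C y" "cmp C g a = cmp C b g"
          using right_deterministic hom_obj[OF g'] g' HG(1)
          unfolding right_deterministic_def by blast
        have p: "(a, g, b) \<in> mor (adjoint_cat C)"
          using g HG(1) b by (simp add: mor_adjoint_iff x_def y_def)
        \<comment> \<open>That \<open>h\<close> intertwines \<open>b\<close> with \<open>c\<close>
          is checked after composing with \<open>g\<close>, where \<open>h \<circ> b \<circ> g = h
          \<circ> g \<circ> a = c \<circ> h \<circ> g\<close>; then \<open>g\<close> is
          cancelled.\<close>
        have "cmp C (cmp C h b) g = cmp C (cmp C c h) g"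
          using cmp_assoc[OF g' b(1) h'] cmp_assoc[OF HG(1) g' h'] cmp_assoc[OF g' h' HG(2)]
            HG(3) b(2) by simp
        then have "cmp C h b = cmp C c h"
          using cancel_right[OF g' cmp_in[OF b(1) h'] cmp_in[OF h' HG(2)]] by blast
        then have q: "(b, h, c) \<in> mor (adjoint_cat C)"
          using h HG(2) b h' by (auto simp: mor_adjoint_iff hom_set_def)
        have "T (a, cmp C h g, c) = T (b, h, c) + T (a, g, b)"
        proof -
          have "T (cmp (adjoint_cat C) (b, h, c) (a, g, b)) = T (b, h, c) + T (a, g, b)"
            using T p q by (auto simp: characters_def adjoint_cat_def)
          then show ?thesis by (simp add: adjoint_cat_def)
        qed
        then show ?thesis
          unfolding hga(2) lookup_leibniz[OF p q g' h' Kg Kh]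
          by (simp only: lookup_char_vec[OF p] lookup_char_vec[OF q] lookup_char_vec[OF hga(1)])
      qed
    qed
    then show ?thesis
      using True by (simp add: cat_mult_basis char_lin_basis g h hg_mor)
  qed
qed

text \<open>Both sides are linear in each argument, so span induction on \<open>v\<close> and then
  on \<open>u\<close> reduces the rule to basis vectors.\<close>

lemma char_lin_leibniz:
  fixes T :: "'m \<times> 'm \<times> 'm \<Rightarrow> 'k::field"
  assumes T: "T \<in> characters (adjoint_cat C)" and u: "u \<in> cat_alg C" and v: "v \<in> cat_alg C"
  shows "char_lin T (cat_mult C u v) = cat_mult C (char_lin T u) v + cat_mult C u (char_lin T v)"
proof -
  have *: "char_lin T (cat_mult C (basis_vec h) v) =
      cat_mult C (char_lin T (basis_vec h)) v + cat_mult C (basis_vec h) (char_lin T v)"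
    if h: "h \<in> mor C" for h
    using v unfolding cat_alg_def
  proof (rule pm.span_induct)
    show "pm.subspace {v. char_lin T (cat_mult C (basis_vec h) v) =
      cat_mult C (char_lin T (basis_vec h)) v + cat_mult C (basis_vec h) (char_lin T v)}"
      by (rule pm.subspaceI)
        (auto simp: char_lin_add char_lin_scale cat_mult_add_right cat_mult_scale_right
          pm.scale_right_distrib)
  qed (use char_lin_leibniz_basis[OF T h] in auto)
  show ?thesis
    using u unfolding cat_alg_def
  proof (rule pm.span_induct)
    show "pm.subspace {u. char_lin T (cat_mult C u v) =
      cat_mult C (char_lin T u) v + cat_mult C u (char_lin T v)}"
      by (rule pm.subspaceI)
        (auto simp: char_lin_add char_lin_scale cat_mult_add_left cat_mult_scale_left
          pm.scale_right_distrib)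
  qed (use * in auto)
qed

lemma char_lin_span:
  fixes u :: "'m \<Rightarrow>\<^sub>0 'k::field"
  assumes "u \<in> pm.span (basis_vec ` hom_set C x y)"
  shows "char_lin T u \<in> pm.span (basis_vec ` hom_set C x y)"
  using assms
proof (rule pm.span_induct)
  show "pm.subspace {u. char_lin T u \<in> pm.span (basis_vec ` hom_set C x y)}"
    by (rule pm.subspaceI)
      (auto simp: char_lin_add char_lin_scale intro: pm.span_zero pm.span_add pm.span_scale)
next
  fix w :: "'m \<Rightarrow>\<^sub>0 'k"
  assume "w \<in> basis_vec ` hom_set C x y"
  then obtain g where "w = basis_vec g" and g: "g \<in> hom_set C x y" by blast
  moreover have "g \<in> mor C" using g by (simp add: hom_set_def)
  ultimately show "char_lin T w \<in> pm.span (basis_vec ` hom_set C x y)"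
    by (simp add: char_lin_basis span_basis_iff keys_char_vec[OF g])
qed

text \<open>This holds for arbitrary \<open>u\<close> because \<open>char_lin\<close> reads only
  coordinates in \<open>mor C\<close>.\<close>

lemma char_lin_cat_alg: "char_lin T u \<in> cat_alg C"
proof -
  have "char_vec T g \<in> cat_alg C" if "g \<in> mor C" for g
    using keys_char_vec[OF hom_mor[OF that]] by (fastforce simp: cat_alg_iff hom_set_def)
  then show ?thesis
    unfolding char_lin_def cat_alg_def by (intro pm.span_sum pm.span_scale)
qed

lemma cat_mult_cat_alg:
  assumes "u \<in> cat_alg C" "v \<in> cat_alg C"
  shows "cat_mult C u v \<in> cat_alg C"
proof -
  have "cmp C a b \<in> mor C" if "a \<in> mor C" "b \<in> mor C" "src C a = tgt C b" for a b
    using cmp_in[of b "src C b" "tgt C b" a "tgt C a"] that by (simp add: hom_set_def)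
  then show ?thesis
    using assms keys_cat_mult[of C u v] unfolding cat_alg_iff by blast
qed

lemma der_char_surj:
  fixes T :: "'m \<times> 'm \<times> 'm \<Rightarrow> 'k::field"
  assumes T: "T \<in> characters (adjoint_cat C)"
  shows "T \<in> der_char ` graded_der C"
proof
  \<comment> \<open>The cutoff is the convention of \<open>graded_der\<close>. It does not disturb
    the Leibniz rule, as the algebra is closed under products.\<close>
  define X where "X u = (if u \<in> cat_alg C then char_lin T u else 0)" for u
  have sub: "pm.subspace (cat_alg C :: ('m \<Rightarrow>\<^sub>0 'k) set)"
    by (simp add: cat_alg_def)
  have "linear_on pm_scale pm_scale (cat_alg C) (cat_alg C) X"
    using char_lin_cat_alg pm.subspace_add[OF sub] pm.subspace_scale[OF sub]
    by (auto simp: linear_on_def X_def char_lin_add char_lin_scale)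
  moreover have "\<forall>u \<in> cat_alg C. \<forall>v \<in> cat_alg C.
      X (cat_mult C u v) = cat_mult C (X u) v + cat_mult C u (X v)"
    by (simp add: X_def cat_mult_cat_alg char_lin_leibniz[OF T])
  moreover have "graded_map C X"
    unfolding graded_map_def
  proof (intro ballI subsetI)
    fix s v assume "v \<in> X ` grading_comp C s"
    then show "v \<in> grading_comp C s"
      by (cases "(C, s)" rule: grading_comp.cases)
        (auto simp: X_def char_lin_span pm.span_zero)
  qed
  ultimately show "X \<in> graded_der C"
    by (simp add: graded_der_def X_def)
  show "T = der_char X"
  proof
    fix p :: "'m \<times> 'm \<times> 'm"
    obtain a g b where p: "p = (a, g, b)" by (cases p)
    show "T p = der_char X p"
    proof (cases "p \<in> mor (adjoint_cat C)")
      case True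
      then have g: "g \<in> mor C" by (simp add: p mor_adjoint_iff)
      then have "X (basis_vec g) = char_vec T g"
        by (simp add: X_def cat_alg_iff char_lin_basis)
      then show ?thesis
        using True by (simp add: p der_char_apply lookup_char_vec)
    next
      case False
      then show ?thesis
        using T by (simp add: p der_char_def characters_def)
    qed
  qed
qed

section \<open>The linear isomorphism\<close>

text \<open>Each value of \<open>der_char X\<close> is either 0 or a coefficient of \<open>X\<close>
  at a fixed vector, hence linear in \<open>X\<close> under pointwise operations.\<close>

lemma linear_iso_der_char:
  "linear_iso_on (fun_scale pm_scale) (fun_scale (*))
    (graded_der C :: (('m \<Rightarrow>\<^sub>0 'k::field) \<Rightarrow> ('m \<Rightarrow>\<^sub>0 'k)) set)
    (characters (adjoint_cat C)) der_char"
  unfolding linear_iso_on_def linear_on_def bij_betw_def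
  using der_char_character der_char_surj der_char_inj
  by (auto simp: der_char_def fun_scale_def lookup_add fun_eq_iff)

end

theorem theorem3:
  fixes C :: "('o, 'm) cat"
  assumes "finite_category C"
    and "rr_transitive C"
    and "deterministic C"
    and "cancellative C"
  shows "\<exists>\<T> :: (('m \<Rightarrow>\<^sub>0 'k::field) \<Rightarrow> ('m \<Rightarrow>\<^sub>0 'k)) \<Rightarrow> ('m \<times> 'm \<times> 'm \<Rightarrow> 'k).
    linear_iso_on (fun_scale pm_scale) (fun_scale (*))
      (graded_der C) (characters (adjoint_cat C)) \<T>"
proof -
  interpret finite_category C by fact
  interpret rr_right_deterministic_category C
    using assms by unfold_locales (auto simp: deterministic_def)
  show ?thesis
    using linear_iso_der_char by blast
qed

end
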